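(* As formal power series, \[ \sum_{n=0}^{\infty}\sum_{\pi\in\mathfrak{J}_{n}}t^{\operatorname{lrmin}(\pi)}\frac{x^{n}}{n!}=(\sec x+\tan x)^{t}. \]
   Context: A permutation of a finite set $S$ of positive integers is a word $\pi=\pi_1\cdots\pi_n$ ($n=|S|$) in which each element of $S$ appears exactly once; the empty word is the unique permutation of the empty set. $\mathfrak{S}_n$ denotes the set of permutations of $\{1,\dots,n\}$. For a permutation $\pi$ and a letter $x$ of $\pi$, let $\rho_\pi(x)$ be the maximal consecutive subword of $\pi$ consisting of the letters immediately to the right of $x$ that are all larger than $x$. A permutation $\pi$ is Jacobi if $|\rho_\pi(x)|$ is even for every letter $x$ of $\pi$. $\mathfrak{J}_n$ is the set of Jacobi permutations in $\mathfrak{S}_n$. A letter $\pi_k$ is a left-to-right minimum of $\pi$ if $\pi_k<\pi_i$ for all $i<k$; $\operatorname{lrmin}(\pi)$ is the number of left-to-right minima (so the empty permutation has $\operatorname{lrmin}=0$). *)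

theory Defs
  imports
    "HOL-Computational_Algebra.Computational_Algebra"
    "HOL-Combinatorics.Multiset_Permutations"
begin

definition rho :: "nat list \<Rightarrow> nat \<Rightarrow> nat list" where
  "rho \<pi> x = takeWhile (\<lambda>y. x < y) (tl (dropWhile (\<lambda>y. y \<noteq> x) \<pi>))"

definition Jacobi :: "nat list \<Rightarrow> bool" where
  "Jacobi \<pi> \<longleftrightarrow> (\<forall>x\<in>set \<pi>. even (length (rho \<pi> x)))"

definition Jacobi_perms :: "nat \<Rightarrow> nat list set" where
  "Jacobi_perms n = {\<pi> \<in> permutations_of_set {1..n}. Jacobi \<pi>}"

definition lrmin :: "nat list \<Rightarrow> nat" where
  "lrmin \<pi> = card {k. k < length \<pi> \<and> (\<forall>i<k. \<pi> ! k < \<pi> ! i)}"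

text \<open>
  Series in \<open>x\<close> whose coefficients are polynomials in the indeterminate \<open>t = [:0, 1:]\<close>
  have type \<open>'a poly fps\<close>; \<open>fps_lift_poly\<close> is the embedding of the series not involving \<open>t\<close>.
\<close>

definition fps_lift_poly :: "'a::zero fps \<Rightarrow> 'a poly fps" where
  "fps_lift_poly F = Abs_fps (\<lambda>n. [:fps_nth F n:])"

definition fps_sec :: "'a::field_char_0 \<Rightarrow> 'a fps" where
  "fps_sec c = inverse (fps_cos c)"

text \<open>The binomial coefficient \<open>t(t - 1)\<dots>(t - k + 1) / k!\<close> as a polynomial in \<open>t\<close>.\<close>

definition binomial_poly :: "nat \<Rightarrow> 'a::field_char_0 poly" where
  "binomial_poly k = smult (1 / fact k) (\<Prod>i<k. [:0, 1:] - of_nat i)"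

text \<open>
  For \<open>F\<close> with constant term \<open>1\<close>, the power \<open>F\<^sup>t\<close> is the binomial series
  \<open>\<Sum>k. binomial_poly k * (F - 1) ^ k\<close>. Composition is only meaningful for an inner series
  without constant term, so the definition is not to be used for other \<open>F\<close>.
\<close>

definition fps_power_indet :: "'a::field_char_0 fps \<Rightarrow> 'a poly fps" where
  "fps_power_indet F = Abs_fps binomial_poly oo fps_lift_poly (F - 1)"

lemma sec_plus_tan_nth_0: "fps_nth (fps_sec c + fps_tan c) 0 = 1"
  by (simp add: fps_sec_def fps_tan_def fps_divide_unit)

lemma poly_binomial_poly: "poly (binomial_poly k) c = c gchoose k"
  by (simp add: binomial_poly_def poly_prod gbinomial_prod_rev atLeast0LessThan)

lemma fps_lift_poly_power_nth:
  "fps_nth (fps_lift_poly F ^ k) n = [:fps_nth ((F :: 'a::field_char_0 fps) ^ k) n:]"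
proof (induction k arbitrary: n)
  case 0
  show ?case by (simp add: one_pCons)
next
  case (Suc k)
  have "(\<Sum>i\<in>A. [:f i:]) = [:\<Sum>i\<in>A. f i:]" for f :: "nat \<Rightarrow> 'a" and A
    by (induction A rule: infinite_finite_induct) auto
  with Suc show ?case
    by (simp add: fps_mult_nth fps_lift_poly_def mult.commute)
qed

text \<open>Specialising \<open>t\<close> to a scalar gives the binomial series with that exponent.\<close>

lemma poly_fps_power_indet:
  "poly (fps_nth (fps_power_indet F) n) c = fps_nth (fps_binomial c oo (F - 1)) n"
  by (simp add: fps_power_indet_def fps_compose_nth poly_sum poly_binomial_poly
      fps_lift_poly_power_nth mult.commute)

lemma poly_fps_power_indet_of_nat:
  assumes "fps_nth F 0 = 1"
  shows "poly (fps_nth (fps_power_indet F) n) (of_nat m) = fps_nth (F ^ m) n"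
proof -
  have "fps_binomial (of_nat m) oo (F - 1) = F ^ m"
    using assms
    by (simp add: fps_binomial_of_nat fps_compose_power [symmetric] fps_compose_add_distrib)
  thus ?thesis
    by (simp add: poly_fps_power_indet)
qed

end

theory Submission
  imports Defs
begin

text \<open>
  Splitting a permutation at its least letter, \<open>\<pi> = \<alpha> m \<beta>\<close>, the word \<open>\<pi>\<close> is Jacobi iff \<open>\<alpha>\<close> and
  \<open>\<beta>\<close> are Jacobi and \<open>\<beta>\<close> has even length, and \<open>lrmin \<pi> = lrmin \<alpha> + 1\<close>. Hence the generating
  function \<open>F\<^sub>t\<close> satisfies \<open>F\<^sub>t' = t F\<^sub>t E\<close>, where \<open>E\<close> is the even part of \<open>F\<^sub>1\<close>. These equations
  determine all \<open>F\<^sub>t\<close>, and \<open>(sec x + tan x)\<^sup>t\<close> solves them because \<open>(sec + tan)' = sec (sec + tan)\<close>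
  and \<open>sec\<close> is the even part of \<open>sec + tan\<close>.
\<close>

section \<open>Splitting at the least letter\<close>

lemma rho_append_left:
  assumes "x \<in> set \<alpha>" "m < x"
  shows "rho (\<alpha> @ m # \<beta>) x = rho \<alpha> x"
proof -
  \<comment> \<open>As \<open>x\<close> occurs in \<open>\<alpha>\<close>, \<open>tl\<close> removes
    \<open>x\<close> itself and leaves \<open>m # \<beta>\<close> intact, so
    \<open>takeWhile\<close> stops at \<open>m\<close> at the latest.\<close>
  have "dropWhile (\<lambda>y. y \<noteq> x) \<alpha> \<noteq> []"
    using assms(1) by simp
  with assms show ?thesis
    by (simp add: rho_def dropWhile_append1 takeWhile_tail)
qed

lemma rho_append_mid:
  assumes "m \<notin> set \<alpha>" "\<forall>y\<in>set \<beta>. m < y"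
  shows "rho (\<alpha> @ m # \<beta>) m = \<beta>"
proof -
  have "dropWhile (\<lambda>y. y \<noteq> m) (\<alpha> @ m # \<beta>) = m # \<beta>"
    using assms(1) by (subst dropWhile_append2) auto
  with assms(2) show ?thesis
    by (simp add: rho_def)
qed

lemma rho_append_right:
  assumes "x \<notin> set \<alpha>" "x \<noteq> m"
  shows "rho (\<alpha> @ m # \<beta>) x = rho \<beta> x"
proof -
  have "dropWhile (\<lambda>y. y \<noteq> x) (\<alpha> @ m # \<beta>) = dropWhile (\<lambda>y. y \<noteq> x) \<beta>"
    using assms by (subst dropWhile_append2) auto
  thus ?thesis
    by (simp add: rho_def)
qed

text \<open>A run starting in \<open>\<alpha>\<close> cannot pass the smaller \<open>m\<close>, a
  run in \<open>\<beta>\<close> does not see what precedes it, and the run of \<open>m\<close> is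
  all of \<open>\<beta>\<close>, whence the parity condition.\<close>

lemma Jacobi_split_min:
  assumes "distinct (\<alpha> @ m # \<beta>)" "\<forall>y\<in>set \<alpha> \<union> set \<beta>. m < y"
  shows "Jacobi (\<alpha> @ m # \<beta>) \<longleftrightarrow> Jacobi \<alpha> \<and> Jacobi \<beta> \<and> even (length \<beta>)"
proof -
  have "rho (\<alpha> @ m # \<beta>) x = rho \<alpha> x" if "x \<in> set \<alpha>" for x
    using that assms(2) by (intro rho_append_left) auto
  moreover have "rho (\<alpha> @ m # \<beta>) x = rho \<beta> x" if "x \<in> set \<beta>" for x
    using that assms(1) by (intro rho_append_right) auto
  moreover have "rho (\<alpha> @ m # \<beta>) m = \<beta>"
    using assms by (intro rho_append_mid) auto
  ultimately show ?thesis
    unfolding Jacobi_def by (simp add: ball_Un) blast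
qed

text \<open>\<open>m\<close> undercuts all of \<open>\<alpha>\<close>, and no letter of
  \<open>\<beta>\<close> undercuts \<open>m\<close>.\<close>

lemma lrmin_split_min:
  assumes "\<forall>y\<in>set \<alpha> \<union> set \<beta>. m < y"
  shows "lrmin (\<alpha> @ m # \<beta>) = Suc (lrmin \<alpha>)"
proof -
  let ?\<pi> = "\<alpha> @ m # \<beta>"
  let ?L = "{k. k < length \<alpha> \<and> (\<forall>i<k. \<alpha> ! k < \<alpha> ! i)}"
  have "(k < length ?\<pi> \<and> (\<forall>i<k. ?\<pi> ! k < ?\<pi> ! i)) \<longleftrightarrow> k \<in> insert (length \<alpha>) ?L" for k
  proof (cases k "length \<alpha>" rule: linorder_cases)
    case less
    thus ?thesis by (auto simp: nth_append)
  next
    case equal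
    thus ?thesis using assms by (auto simp: nth_append)
  next
    case greater
    \<comment> \<open>Position \<open>length \<alpha>\<close> holds \<open>m\<close>; it is the
      witness against every later position.\<close>
    have "\<not> (k < length ?\<pi> \<and> ?\<pi> ! k < ?\<pi> ! length \<alpha>)"
    proof
      assume k: "k < length ?\<pi> \<and> ?\<pi> ! k < ?\<pi> ! length \<alpha>"
      with greater have "?\<pi> ! k = \<beta> ! (k - Suc (length \<alpha>))" "k - Suc (length \<alpha>) < length \<beta>"
        by (auto simp: nth_append nth_Cons')
      with assms have "m < ?\<pi> ! k" by auto
      with k show False by simp
    qed
    with greater show ?thesis by auto
  qed
  hence "{k. k < length ?\<pi> \<and> (\<forall>i<k. ?\<pi> ! k < ?\<pi> ! i)} = insert (length \<alpha>) ?L"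
    by blast
  thus ?thesis
    by (simp add: lrmin_def)
qed

text \<open>The scalar \<open>c\<close> stands for the indeterminate. Arbitrary letter sets are
  allowed so that the two pieces of a split need no relabelling.\<close>

definition Jacobi_sum :: "'a::comm_semiring_1 \<Rightarrow> nat set \<Rightarrow> 'a" where
  "Jacobi_sum c A = (\<Sum>\<pi> | \<pi> \<in> permutations_of_set A \<and> Jacobi \<pi>. c ^ lrmin \<pi>)"

lemma Jacobi_sum_empty: "Jacobi_sum c {} = 1"
proof -
  have "{\<pi>. \<pi> \<in> permutations_of_set {} \<and> Jacobi \<pi>} = {[]}"
    by (auto simp: Jacobi_def)
  thus ?thesis
    by (simp add: Jacobi_sum_def lrmin_def)
qed

text \<open>The inverse map cuts a word at \<open>m\<close>; \<open>B\<close> records the letters to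
  the right of the cut.\<close>

lemma bij_betw_split_at:
  assumes "m \<in> A"
  shows "bij_betw (\<lambda>(B, \<alpha>, \<beta>). \<alpha> @ m # \<beta>)
    (SIGMA B : Pow (A - {m}). permutations_of_set (A - {m} - B) \<times> permutations_of_set B)
    (permutations_of_set A)"
proof (rule bij_betw_imageI)
  show "inj_on (\<lambda>(B, \<alpha>, \<beta>). \<alpha> @ m # \<beta>)
    (SIGMA B : Pow (A - {m}). permutations_of_set (A - {m} - B) \<times> permutations_of_set B)"
  proof (rule inj_onI)
    fix p q
    assume *: "(case p of (B, \<alpha>, \<beta>) \<Rightarrow> \<alpha> @ m # \<beta>) = (case q of (B, \<alpha>, \<beta>) \<Rightarrow> \<alpha> @ m # \<beta>)"
      "p \<in> (SIGMA B : Pow (A - {m}). permutations_of_set (A - {m} - B) \<times> permutations_of_set B)"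
      "q \<in> (SIGMA B : Pow (A - {m}). permutations_of_set (A - {m} - B) \<times> permutations_of_set B)"
    obtain B \<alpha> \<beta> B' \<alpha>' \<beta>' where pq: "p = (B, \<alpha>, \<beta>)" "q = (B', \<alpha>', \<beta>')"
      by (metis prod_cases3)
    \<comment> \<open>As \<open>m\<close> occurs only once, the word determines the cut, and
      \<open>\<beta>\<close> determines \<open>B\<close>.\<close>
    with * have "m \<notin> set \<alpha>" "m \<notin> set \<beta>" "set \<beta> = B" "set \<beta>' = B'"
      by (auto simp: permutations_of_set_def)
    with *(1) show "p = q"
      by (auto simp: pq append_Cons_eq_iff)
  qed
  show "(\<lambda>(B, \<alpha>, \<beta>). \<alpha> @ m # \<beta>) `
    (SIGMA B : Pow (A - {m}). permutations_of_set (A - {m} - B) \<times> permutations_of_set B)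
    = permutations_of_set A" (is "?f ` ?S = _")
  proof (intro equalityI subsetI)
    fix \<pi> assume "\<pi> \<in> ?f ` ?S"
    thus "\<pi> \<in> permutations_of_set A"
      using assms by (auto simp: permutations_of_set_def)
  next
    fix \<pi> assume \<pi>: "\<pi> \<in> permutations_of_set A"
    hence "m \<in> set \<pi>" using assms by (simp add: permutations_of_set_def)
    then obtain \<alpha> \<beta> where "\<pi> = \<alpha> @ m # \<beta>" by (meson split_list)
    with \<pi> show "\<pi> \<in> ?f ` ?S"
      by (intro image_eqI[of _ _ "(set \<beta>, \<alpha>, \<beta>)"]) (auto simp: permutations_of_set_def)
  qed
qed

text \<open>Letters of the right piece are never left-to-right minima of the whole word, so this
  piece is counted with \<open>1\<close> in place of \<open>c\<close>.\<close>

lemma Jacobi_sum_split_min: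
  assumes "finite A" "A \<noteq> {}"
  shows "Jacobi_sum c A = c * (\<Sum>B\<in>Pow (A - {Min A}).
    if even (card B) then Jacobi_sum c (A - {Min A} - B) * Jacobi_sum 1 B else 0)"
proof -
  define m where "m = Min A"
  define P where "P = (\<lambda>A. permutations_of_set A :: nat list set)"
  \<comment> \<open>Weight zero for words that are not Jacobi lets the sums range over full product
    sets, where they factor.\<close>
  define w where "w = (\<lambda>c \<pi>. if Jacobi \<pi> then c ^ lrmin \<pi> else (0::'a))"
  have W: "Jacobi_sum c A = (\<Sum>\<pi>\<in>P A. w c \<pi>)" for c A
    unfolding Jacobi_sum_def w_def P_def
    by (subst sum.inter_filter [symmetric]) (simp_all add: Collect_conj_eq)
  have m: "m \<in> A" "\<And>y. y \<in> A - {m} \<Longrightarrow> m < y"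
    using assms by (auto simp: m_def order.strict_iff_order)
  have split: "w c (\<alpha> @ m # \<beta>) = c * (if even (card B) then w c \<alpha> * w 1 \<beta> else 0)"
    if "B \<in> Pow (A - {m})" "\<alpha> \<in> P (A - {m} - B)" "\<beta> \<in> P B" for B \<alpha> \<beta>
  proof -
    have "distinct (\<alpha> @ m # \<beta>)"
      using that by (auto simp: P_def permutations_of_set_def)
    moreover have "\<forall>y\<in>set \<alpha> \<union> set \<beta>. m < y"
      using that m(2) by (auto simp: P_def permutations_of_set_def)
    moreover have "length \<beta> = card B"
      using that(3) by (auto simp: P_def permutations_of_set_def distinct_card)
    ultimately show ?thesis
      by (simp add: w_def Jacobi_split_min lrmin_split_min)
  qed
  have "Jacobi_sum c A =
      (\<Sum>(B, \<alpha>, \<beta>)\<in>(SIGMA B : Pow (A - {m}). P (A - {m} - B) \<times> P B). w c (\<alpha> @ m # \<beta>))"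
    unfolding W P_def
    by (subst sum.reindex_bij_betw [OF bij_betw_split_at [OF m(1)], symmetric])
       (simp add: case_prod_unfold)
  also have "\<dots> = (\<Sum>B\<in>Pow (A - {m}). \<Sum>(\<alpha>, \<beta>)\<in>P (A - {m} - B) \<times> P B. w c (\<alpha> @ m # \<beta>))"
    using assms(1) by (subst sum.Sigma) (auto simp: P_def)
  also have "\<dots> = (\<Sum>B\<in>Pow (A - {m}). \<Sum>(\<alpha>, \<beta>)\<in>P (A - {m} - B) \<times> P B.
      c * (if even (card B) then w c \<alpha> * w 1 \<beta> else 0))"
    using split by (intro sum.cong refl) auto
  also have "\<dots> = (\<Sum>B\<in>Pow (A - {m}).
      c * (if even (card B) then Jacobi_sum c (A - {m} - B) * Jacobi_sum 1 B else 0))"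
    unfolding W sum_product sum.cartesian_product
    by (intro sum.cong refl) (simp add: case_prod_unfold sum_distrib_left)
  finally show ?thesis
    unfolding m_def sum_distrib_left .
qed

lemma sum_Pow_card:
  fixes f :: "nat \<Rightarrow> 'a::comm_semiring_1"
  assumes "finite A"
  shows "(\<Sum>B\<in>Pow A. f (card B)) = (\<Sum>k\<le>card A. of_nat (card A choose k) * f k)"
proof -
  have "(\<Sum>B\<in>Pow A. f (card B)) = (\<Sum>k\<le>card A. \<Sum>B\<in>{B \<in> Pow A. card B = k}. f (card B))"
    using assms by (intro sum.group [symmetric]) (auto simp: card_mono)
  also have "\<dots> = (\<Sum>k\<le>card A. of_nat (card A choose k) * f k)"
    using assms by (intro sum.cong refl) (simp add: n_subsets)
  finally show ?thesis .
qed

section \<open>The differential equation of \<open>(sec x + tan x)\<^sup>c\<close>\<close>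

text \<open>Evenness is expressed as invariance under substituting \<open>- fps_X\<close>; it passes
  from the cosine to its inverse.\<close>

lemma fps_sec_compose_uminus: "fps_sec c oo - fps_X = fps_sec c"
proof -
  have "fps_cos c oo - fps_X = fps_cos c"
    by (simp add: fps_compose_uminus' fps_eq_iff fps_cos_def)
  thus ?thesis
    by (simp add: fps_sec_def fps_inverse_compose)
qed

lemma fps_tan_eq_sin_mult_sec: "fps_tan c = fps_sin c * fps_sec c"
  by (simp add: fps_tan_def fps_sec_def fps_divide_unit)

lemma fps_tan_compose_uminus: "fps_tan c oo - fps_X = - fps_tan c"
proof -
  have "fps_sin c oo - fps_X = - fps_sin c"
    by (simp add: fps_compose_uminus' fps_eq_iff fps_sin_def)
  thus ?thesis
    by (simp add: fps_tan_eq_sin_mult_sec fps_compose_mult_distrib fps_sec_compose_uminus)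
qed

text \<open>The substitution multiplies the coefficient by \<open>(-1) ^ n\<close>, so for odd
  \<open>n\<close> it equals its own negative.\<close>

lemma fps_sec_nth_odd: "odd n \<Longrightarrow> fps_nth (fps_sec c) n = 0"
  using arg_cong [OF fps_sec_compose_uminus [of c], of "\<lambda>F. fps_nth F n"]
  by (simp add: fps_compose_uminus')

lemma fps_tan_nth_even: "even n \<Longrightarrow> fps_nth (fps_tan c) n = 0"
  using arg_cong [OF fps_tan_compose_uminus [of c], of "\<lambda>F. fps_nth F n"]
  by (simp add: fps_compose_uminus')

lemma fps_sec_nth_eq:
  "fps_nth (fps_sec c) n = (if even n then fps_nth (fps_sec c + fps_tan c) n else 0)"
  by (simp add: fps_sec_nth_odd fps_tan_nth_even)

lemma fps_deriv_sec_plus_tan: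
  "fps_deriv (fps_sec c + fps_tan c) = fps_const c * fps_sec c * (fps_sec c + fps_tan c)"
proof -
  have "fps_deriv (fps_sec c) = fps_const c * fps_sec c * fps_tan c"
    by (simp add: fps_sec_def fps_inverse_deriv fps_cos_deriv fps_tan_def fps_divide_unit
        power2_eq_square algebra_simps flip: fps_const_neg)
  moreover have "fps_deriv (fps_tan c) = fps_const c * fps_sec c * fps_sec c"
    by (simp add: fps_tan_deriv fps_sec_def fps_divide_unit power2_eq_square fps_inverse_mult
        algebra_simps)
  ultimately show ?thesis
    by (simp add: algebra_simps)
qed

text \<open>The power rule for \<open>F\<close> to the exponent \<open>c\<close>, free of division.
  The binomial series \<open>b\<close> satisfies \<open>(1 + X) b' = c b\<close>; substituting
  \<open>F - 1\<close> turns \<open>1 + X\<close> into \<open>F\<close>, and the chain rule supplies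
  \<open>F'\<close>.\<close>

lemma fps_deriv_binomial_compose:
  fixes F :: "'a::field_char_0 fps"
  assumes "fps_nth F 0 = 1"
  shows "F * fps_deriv (fps_binomial c oo (F - 1)) =
    fps_const c * (fps_binomial c oo (F - 1)) * fps_deriv F"
proof -
  have F0: "fps_nth (F - 1) 0 = 0" using assms by simp
  have "(1 + fps_X) * fps_deriv (fps_binomial c) = fps_const c * fps_binomial c"
    by (simp add: fps_binomial_deriv fps_divide_unit inverse_mult_eq_1' mult.left_commute)
  hence "((1 + fps_X) * fps_deriv (fps_binomial c)) oo (F - 1) =
      (fps_const c * fps_binomial c) oo (F - 1)"
    by simp
  hence "F * (fps_deriv (fps_binomial c) oo (F - 1)) = fps_const c * (fps_binomial c oo (F - 1))"
    using F0 by (simp add: fps_compose_mult_distrib fps_compose_add_distrib)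
  thus ?thesis
    using F0 by (simp add: fps_compose_deriv flip: mult.assoc)
qed

text \<open>By \<open>poly_fps_power_indet\<close>, this is the right-hand side of the theorem
  specialised at \<open>c\<close>.\<close>

abbreviation sec_tan_power :: "'a::field_char_0 \<Rightarrow> 'a fps" where
  "sec_tan_power c \<equiv> fps_binomial c oo (fps_sec 1 + fps_tan 1 - 1)"

lemma fps_deriv_sec_tan_power:
  "fps_deriv (sec_tan_power c) = fps_const c * (sec_tan_power c * fps_sec 1)"
proof -
  let ?S = "fps_sec 1 + fps_tan 1 :: 'a fps"
  \<comment> \<open>Both sides of the power rule contain the factor \<open>?S\<close>, which can be
    cancelled because its constant term is \<open>1\<close>.\<close>
  have "?S \<noteq> 0"
    using sec_plus_tan_nth_0 [of "1::'a"] by (metis fps_zero_nth zero_neq_one)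
  moreover have "?S * fps_deriv (sec_tan_power c) =
      ?S * (fps_const c * (sec_tan_power c * fps_sec 1))"
    by (subst fps_deriv_binomial_compose [OF sec_plus_tan_nth_0], subst fps_deriv_sec_plus_tan)
       (simp add: mult_ac)
  ultimately show ?thesis
    by (metis mult_left_cancel)
qed

lemma sec_tan_power_1: "sec_tan_power 1 = fps_sec 1 + fps_tan 1"
  using sec_plus_tan_nth_0 [of "1::'a"] by (simp add: fps_binomial_1 fps_compose_add_distrib)

text \<open>The coefficient form of the differential equation, with \<open>sec\<close> read as the
  even part of \<open>sec_tan_power 1\<close> to match the recurrence of
  \<open>Jacobi_sum\<close>.\<close>

lemma sec_tan_power_nth_Suc:
  "of_nat (Suc n) * fps_nth (sec_tan_power c) (Suc n) =
    c * (\<Sum>k\<le>n. if even k then fps_nth (sec_tan_power c) (n - k) * fps_nth (sec_tan_power 1) k else 0)"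
proof -
  have "of_nat (Suc n) * fps_nth (sec_tan_power c) (Suc n) =
      fps_nth (fps_deriv (sec_tan_power c)) n"
    by simp
  also have "\<dots> = c * fps_nth (fps_sec 1 * sec_tan_power c) n"
    by (simp only: fps_deriv_sec_tan_power fps_mult_left_const_nth mult.commute)
  also have "fps_nth (fps_sec 1 * sec_tan_power c) n =
      (\<Sum>k\<le>n. fps_nth (fps_sec 1) k * fps_nth (sec_tan_power c) (n - k))"
    by (simp add: fps_mult_nth atLeast0AtMost)
  also have "\<dots> = (\<Sum>k\<le>n.
      if even k then fps_nth (sec_tan_power c) (n - k) * fps_nth (sec_tan_power 1) k else 0)"
    unfolding sec_tan_power_1 by (intro sum.cong refl, subst fps_sec_nth_eq) simp
  finally show ?thesis .
qed

section \<open>The generating function\<close>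

lemma Jacobi_sum_eq:
  fixes c :: "'a::field_char_0"
  assumes "finite A"
  shows "Jacobi_sum c A = fact (card A) * fps_nth (sec_tan_power c) (card A)"
  using assms
\<comment> \<open>The exponent must vary: the recurrence for \<open>c\<close> also calls the case of
  exponent \<open>1\<close>.\<close>
proof (induction "card A" arbitrary: A c rule: less_induct)
  case less
  let ?a = "\<lambda>c::'a. fps_nth (sec_tan_power c)"
  show ?case
  proof (cases "A = {}")
    case True
    thus ?thesis by (simp add: Jacobi_sum_empty)
  next
    case False
    let ?A = "A - {Min A}"
    define n where "n = card ?A"
    have cardA: "card A = Suc n"
      using False less.prems by (simp add: n_def card_gt_0_iff)
    have IH: "Jacobi_sum d B = fact (card B) * ?a d (card B)" if "B \<subseteq> ?A" for B d
    proof (rule less.hyps)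
      show "finite B" using that less.prems finite_subset by blast
      have "card B \<le> n" using that less.prems by (simp add: n_def card_mono)
      thus "card B < card A" by (simp add: cardA)
    qed
    have "Jacobi_sum c A = c * (\<Sum>B\<in>Pow ?A.
        if even (card B) then Jacobi_sum c (?A - B) * Jacobi_sum 1 B else 0)"
      by (rule Jacobi_sum_split_min [OF less.prems False])
    also have "(\<Sum>B\<in>Pow ?A. if even (card B) then Jacobi_sum c (?A - B) * Jacobi_sum 1 B else 0) =
      (\<Sum>B\<in>Pow ?A. if even (card B) then
        fact (n - card B) * ?a c (n - card B) * (fact (card B) * ?a 1 (card B)) else 0)"
    proof (rule sum.cong [OF refl])
      fix B assume B: "B \<in> Pow ?A"
      hence "finite B" using less.prems finite_subset by blast
      with B have "card (?A - B) = n - card B" by (simp add: n_def card_Diff_subset)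
      with B IH [of B 1] IH [of "?A - B" c]
      show "(if even (card B) then Jacobi_sum c (?A - B) * Jacobi_sum 1 B else 0) =
        (if even (card B) then
          fact (n - card B) * ?a c (n - card B) * (fact (card B) * ?a 1 (card B)) else 0)"
        by simp
    qed
    also have "\<dots> = (\<Sum>k\<le>n. of_nat (n choose k) * (if even k then
        fact (n - k) * ?a c (n - k) * (fact k * ?a 1 k) else 0))"
      unfolding n_def using less.prems by (intro sum_Pow_card) simp
    also have "\<dots> = (\<Sum>k\<le>n. fact n * (if even k then ?a c (n - k) * ?a 1 k else 0))"
    proof (rule sum.cong [OF refl])
      fix k assume "k \<in> {..n}"
      \<comment> \<open>The binomial coefficient absorbs the factorials of both pieces, leaving a
        plain convolution.\<close>
      hence "of_nat (n choose k) * (fact (n - k) * fact k) = (fact n :: 'a)"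
        by (simp add: binomial_fact)
      thus "of_nat (n choose k) * (if even k then
          fact (n - k) * ?a c (n - k) * (fact k * ?a 1 k) else 0) =
          fact n * (if even k then ?a c (n - k) * ?a 1 k else 0)"
        by (simp add: algebra_simps flip: \<open>_ = fact n\<close>)
    qed
    also have "c * \<dots> = fact n *
        (c * (\<Sum>k\<le>n. if even k then ?a c (n - k) * ?a 1 k else 0))"
      by (simp add: mult.left_commute flip: sum_distrib_left)
    \<comment> \<open>The factor \<open>Suc n\<close> from differentiation completes
      \<open>fact n\<close> to \<open>fact (card A)\<close>.\<close>
    also have "\<dots> = fact (card A) * ?a c (card A)"
      unfolding sec_tan_power_nth_Suc [symmetric] by (simp add: cardA algebra_simps)
    finally show ?thesis .
  qed
qed

theorem theorem2p6:
  shows "Abs_fps (\<lambda>n. smult (1 / fact n) (\<Sum>\<pi>\<in>Jacobi_perms n. [:0, 1:] ^ lrmin \<pi>))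
    = fps_power_indet (fps_sec 1 + fps_tan 1 :: 'a::field_char_0 fps)"
proof (rule fps_ext)
  fix n
  \<comment> \<open>A field of characteristic zero is infinite, so polynomials in \<open>t\<close>
    that agree at every scalar are equal.\<close>
  have "poly (smult (1 / fact n) (\<Sum>\<pi>\<in>Jacobi_perms n. [:0, 1:] ^ lrmin \<pi>)) c =
      poly (fps_nth (fps_power_indet (fps_sec 1 + fps_tan 1)) n) c" for c :: 'a
    using Jacobi_sum_eq [of "{1..n}" c]
    by (simp add: poly_fps_power_indet poly_sum Jacobi_sum_def Jacobi_perms_def)
  thus "fps_nth (Abs_fps (\<lambda>n. smult (1 / fact n) (\<Sum>\<pi>\<in>Jacobi_perms n. [:0, 1:] ^ lrmin \<pi>))) n =
      fps_nth (fps_power_indet (fps_sec 1 + fps_tan 1 :: 'a fps)) n"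
    by (simp add: poly_eq_poly_eq_iff [symmetric] fun_eq_iff)
qed

end
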